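(* Suppose $(C,\mathbf A)$ (state space $\mathcal X$) and $(\widetilde C,\widetilde{\mathbf A})$ (state space $\widetilde{\mathcal X}$), with common output space $\mathcal Y$, are two observable output-stable pairs with both $\mathbf A$ and $\widetilde{\mathbf A}$ commutative, such that $K^{\mathbf a}_{C,\mathbf A}(\boldsymbol\lambda,\boldsymbol\zeta)=K^{\mathbf a}_{\widetilde C,\widetilde{\mathbf A}}(\boldsymbol\lambda,\boldsymbol\zeta)$ for all $\boldsymbol\lambda,\boldsymbol\zeta\in\mathbb B^d$. Then there is a unitary $U\colon\mathcal X\to\widetilde{\mathcal X}$ with $C=\widetilde CU$ and $A_j=U^{-1}\widetilde A_jU$ for $j=1,\dots,d$.
   Context: $\mathbb B^d$: open unit ball of $\mathbb C^d$. $\mathcal F_d$: free semigroup of words on $\{1,\dots,d\}$, $\mathbf A^v=A_{i_N}\cdots A_{i_1}$ for $v=i_N\cdots i_1$. $(C,\mathbf A)$ is output-stable if $x\mapsto\{C\mathbf A^vx\}_{v\in\mathcal F_d}$ is bounded from $\mathcal X$ into $\ell^2_{\mathcal Y}(\mathcal F_d)$, and observable if $C\mathbf A^vx=0$ for all $v$ implies $x=0$. For commutative $\mathbf A$ and $\mathbf n\in\mathbb Z^d_+$, $\mathbf A^{\mathbf n}=A_1^{n_1}\cdots A_d^{n_d}$, $|\mathbf n|=\sum n_k$, $\mathbf n!=\prod n_k!$, $\boldsymbol\lambda^{\mathbf n}=\prod\lambda_k^{n_k}$. For $\boldsymbol\lambda\in\mathbb B^d$ let $E(\boldsymbol\lambda)\colon\mathcal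 X\to\mathcal Y$, $E(\boldsymbol\lambda)x=\sum_{\mathbf n}\frac{|\mathbf n|!}{\mathbf n!}C\mathbf A^{\mathbf n}x\,\boldsymbol\lambda^{\mathbf n}$ (i.e. $C(I-\sum_j\lambda_jA_j)^{-1}x$), and $K^{\mathbf a}_{C,\mathbf A}(\boldsymbol\lambda,\boldsymbol\zeta)=E(\boldsymbol\lambda)E(\boldsymbol\zeta)^*=C(I-\sum_j\lambda_jA_j)^{-1}(I-\sum_j\overline{\zeta_j}A_j^* )^{-1}C^*$; similarly for $(\widetilde C,\widetilde{\mathbf A})$. *)

theory Defs
  imports "HOL-Analysis.Analysis"
begin

class complex_vector = real_vector +
  fixes scaleC :: "complex \<Rightarrow> 'a \<Rightarrow> 'a" (infixr \<open>*\<^sub>C\<close> 75)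
  assumes scaleC_add_right: "a *\<^sub>C (x + y) = a *\<^sub>C x + a *\<^sub>C y"
    and scaleC_add_left: "(a + b) *\<^sub>C x = a *\<^sub>C x + b *\<^sub>C x"
    and scaleC_scaleC: "a *\<^sub>C (b *\<^sub>C x) = (a * b) *\<^sub>C x"
    and scaleC_one: "1 *\<^sub>C x = x"
    and scaleR_scaleC: "scaleR r x = complex_of_real r *\<^sub>C x"

class complex_inner = complex_vector + real_normed_vector +
  fixes cinner :: "'a \<Rightarrow> 'a \<Rightarrow> complex"
  assumes cinner_commute: "cinner x y = cnj (cinner y x)"
    and cinner_add_left: "cinner (x + y) z = cinner x z + cinner y z"
    and cinner_scaleC_left: "cinner (r *\<^sub>C x) y = cnj r * cinner x y"
    and cinner_Re_nonneg: "0 \<le> Re (cinner x x)"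
    and cinner_eq_zero_iff: "cinner x x = 0 \<longleftrightarrow> x = 0"
    and norm_eq_sqrt_cinner: "norm x = sqrt (Re (cinner x x))"

class chilbert_space = complex_inner + complete_space

definition clinear :: "('a::complex_vector \<Rightarrow> 'b::complex_vector) \<Rightarrow> bool" where
  "clinear f \<longleftrightarrow> (\<forall>x y. f (x + y) = f x + f y) \<and> (\<forall>c x. f (c *\<^sub>C x) = c *\<^sub>C f x)"

definition bounded_clinear :: "('a::complex_inner \<Rightarrow> 'b::complex_inner) \<Rightarrow> bool" where
  "bounded_clinear f \<longleftrightarrow> clinear f \<and> (\<exists>K. \<forall>x. norm (f x) \<le> norm x * K)"

text \<open>Hilbert space adjoint (exists for bounded operators between Hilbert spaces).\<close>
definition cadjoint :: "('a::complex_inner \<Rightarrow> 'b::complex_inner) \<Rightarrow> 'b \<Rightarrow> 'a" where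
  "cadjoint T = (SOME S. \<forall>x y. cinner (T x) y = cinner x (S y))"

definition unitary_op :: "('a::complex_inner \<Rightarrow> 'b::complex_inner) \<Rightarrow> bool" where
  "unitary_op U \<longleftrightarrow> bounded_clinear U \<and> bij U \<and> (\<forall>x y. cinner (U x) (U y) = cinner x y)"

text \<open>Letters are indexed by 0..d-1. A word v = i_N ... i_1 is the list [i_N, ..., i_1];
  A^v = A_{i_N} \<circ> ... \<circ> A_{i_1}.\<close>
definition words :: "nat \<Rightarrow> nat list set" where
  "words d = {v. set v \<subseteq> {..<d}}"

fun wpow :: "(nat \<Rightarrow> 'a \<Rightarrow> 'a) \<Rightarrow> nat list \<Rightarrow> 'a \<Rightarrow> 'a" where
  "wpow A [] = id"
| "wpow A (i # v) = A i \<circ> wpow A v"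

definition output_stable :: "nat \<Rightarrow> ('x::complex_inner \<Rightarrow> 'y::complex_inner) \<Rightarrow> (nat \<Rightarrow> 'x \<Rightarrow> 'x) \<Rightarrow> bool" where
  "output_stable d C A \<longleftrightarrow> (\<exists>M. \<forall>x.
      (\<lambda>v. (norm (C (wpow A v x)))\<^sup>2) summable_on words d \<and>
      (\<Sum>\<^sub>\<infinity>v\<in>words d. (norm (C (wpow A v x)))\<^sup>2) \<le> M * (norm x)\<^sup>2)"

definition observable :: "nat \<Rightarrow> ('x::complex_inner \<Rightarrow> 'y::complex_inner) \<Rightarrow> (nat \<Rightarrow> 'x \<Rightarrow> 'x) \<Rightarrow> bool" where
  "observable d C A \<longleftrightarrow> (\<forall>x. (\<forall>v\<in>words d. C (wpow A v x) = 0) \<longrightarrow> x = 0)"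

definition commutative_tuple :: "nat \<Rightarrow> (nat \<Rightarrow> 'x \<Rightarrow> 'x) \<Rightarrow> bool" where
  "commutative_tuple d A \<longleftrightarrow> (\<forall>i<d. \<forall>j<d. A i \<circ> A j = A j \<circ> A i)"

definition multiidx :: "nat \<Rightarrow> (nat \<Rightarrow> nat) set" where
  "multiidx d = {n. \<forall>j\<ge>d. n j = 0}"

fun mpow :: "(nat \<Rightarrow> 'a \<Rightarrow> 'a) \<Rightarrow> nat \<Rightarrow> (nat \<Rightarrow> nat) \<Rightarrow> 'a \<Rightarrow> 'a" where
  "mpow A 0 n = id"
| "mpow A (Suc k) n = mpow A k n \<circ> (A k ^^ n k)"

definition multinom :: "nat \<Rightarrow> (nat \<Rightarrow> nat) \<Rightarrow> complex" where
  "multinom d n = of_nat (fact (\<Sum>j<d. n j)) / of_nat (\<Prod>j<d. fact (n j))"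

definition mono_pow :: "nat \<Rightarrow> (nat \<Rightarrow> complex) \<Rightarrow> (nat \<Rightarrow> nat) \<Rightarrow> complex" where
  "mono_pow d lam n = (\<Prod>j<d. lam j ^ n j)"

definition unit_ball :: "nat \<Rightarrow> (nat \<Rightarrow> complex) set" where
  "unit_ball d = {lam. (\<Sum>j<d. (cmod (lam j))\<^sup>2) < 1}"

definition Eop :: "nat \<Rightarrow> ('x::complex_inner \<Rightarrow> 'y::chilbert_space) \<Rightarrow> (nat \<Rightarrow> 'x \<Rightarrow> 'x)
    \<Rightarrow> (nat \<Rightarrow> complex) \<Rightarrow> 'x \<Rightarrow> 'y" where
  "Eop d C A lam x = (\<Sum>\<^sub>\<infinity>n\<in>multiidx d. (multinom d n * mono_pow d lam n) *\<^sub>C C (mpow A d n x))"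

definition kernel_a :: "nat \<Rightarrow> ('x::chilbert_space \<Rightarrow> 'y::chilbert_space) \<Rightarrow> (nat \<Rightarrow> 'x \<Rightarrow> 'x)
    \<Rightarrow> (nat \<Rightarrow> complex) \<Rightarrow> (nat \<Rightarrow> complex) \<Rightarrow> 'y \<Rightarrow> 'y" where
  "kernel_a d C A lam \<zeta> = Eop d C A lam \<circ> cadjoint (Eop d C A \<zeta>)"

end

theory Submission
  imports Defs
begin

text \<open>
  Only points of a small polydisc around the origin are needed; there the operators
  \<open>E \<lambda>\<close> and \<open>Et \<lambda>\<close> are given by series that converge absolutely because all operators
  involved are bounded. Vanishing of \<open>E \<lambda> x - Et \<lambda> xt\<close> on the polydisc forces every coefficient
  \<open>C A^n x - Ct At^n xt\<close> to vanish: the substitution \<open>\<lambda>_j = z^(w j)\<close> with weights \<open>w\<close> that separate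
  a given exponent from all others reduces this to power series in one variable.

  Let \<open>R\<close> be the space of all pairs \<open>(u, v)\<close> with \<open>E \<lambda> u = Et \<lambda> v\<close> for all \<open>\<lambda>\<close>, that is, the
  orthogonal complement of all \<open>(E \<lambda>* y, - Et \<lambda>* y)\<close>. Equality of the kernels says that \<open>R\<close>
  contains all \<open>(E \<lambda>* y, Et \<lambda>* y)\<close>. With \<open>M\<close> the space of pairs \<open>(a, b)\<close> such that
  \<open>\<langle>u, a\<rangle> = \<langle>v, b\<rangle>\<close> for all \<open>(u, v) \<in> R\<close>, this gives \<open>M \<subseteq> R\<close>, and projecting onto \<open>M\<close> in
  the product Hilbert space shows \<open>M = R\<close>. Projecting \<open>(x, 0)\<close> and \<open>(0, v)\<close> onto \<open>M\<close> shows that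
  \<open>R\<close> is total on both sides. By observability \<open>R\<close> is therefore the graph of a bijection \<open>U\<close>,
  which is isometric because \<open>R = M\<close>. Comparing the coefficients of \<open>E \<lambda> = Et \<lambda> U\<close> gives
  \<open>C A^v = Ct At^v U\<close> for all words, and observability then yields \<open>U A_j = At_j U\<close>.
\<close>

section \<open>Complex Hilbert spaces\<close>

instance chilbert_space \<subseteq> banach
  by standard

section \<open>Algebra of the inner product and the Cauchy-Schwarz inequality\<close>

lemma scaleC_zero_left [simp]: "0 *\<^sub>C (x::'a::complex_vector) = 0"
  using scaleR_scaleC[of 0 x] by simp

lemma scaleC_minus1: "(-1) *\<^sub>C (x::'a::complex_vector) = - x"
  using scaleR_scaleC[of "-1" x] by simp

lemma cinner_zero_left [simp]: "cinner 0 (x::'a::complex_inner) = 0"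
  using cinner_add_left[of 0 0 x] by simp

lemma cinner_add_right: "cinner (x::'a::complex_inner) (y + z) = cinner x y + cinner x z"
  by (metis cinner_add_left cinner_commute complex_cnj_add)

lemma cinner_scaleC_right: "cinner (x::'a::complex_inner) (c *\<^sub>C y) = c * cinner x y"
  by (metis cinner_commute cinner_scaleC_left complex_cnj_cnj complex_cnj_mult)

lemma cinner_zero_right [simp]: "cinner (x::'a::complex_inner) 0 = 0"
  using cinner_add_right[of x 0 0] by simp

lemma cinner_minus_left: "cinner (- x) (y::'a::complex_inner) = - cinner x y"
  using cinner_scaleC_left[of "-1" x y] by (simp add: scaleC_minus1)

lemma cinner_minus_right: "cinner (x::'a::complex_inner) (- y) = - cinner x y"
  using cinner_scaleC_right[of x "-1" y] by (simp add: scaleC_minus1)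

lemma cinner_diff_left: "cinner (x - y) (z::'a::complex_inner) = cinner x z - cinner y z"
  using cinner_add_left[of x "- y" z] by (simp add: cinner_minus_left)

lemma cinner_diff_right: "cinner (z::'a::complex_inner) (x - y) = cinner z x - cinner z y"
  using cinner_add_right[of z x "- y"] by (simp add: cinner_minus_right)

lemma cinner_scaleR_right: "cinner (x::'a::complex_inner) (r *\<^sub>R y) = r *\<^sub>R cinner x y"
  by (simp add: scaleR_scaleC cinner_scaleC_right scaleR_conv_of_real)

lemma power2_norm_cinner: "(norm (x::'a::complex_inner))\<^sup>2 = Re (cinner x x)"
  by (simp add: norm_eq_sqrt_cinner cinner_Re_nonneg)

lemma cinner_self: "cinner x (x::'a::complex_inner) = complex_of_real ((norm x)\<^sup>2)"
proof -
  have "Im (cinner x x) = 0"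
    using cinner_commute[of x x] by (metis complex_cnj_cancel_iff cnj.simps(2) neg_equal_zero)
  then show ?thesis
    by (simp add: complex_eq_iff power2_norm_cinner)
qed

lemma norm_scaleC: "norm (c *\<^sub>C (x::'a::complex_inner)) = cmod c * norm x"
proof -
  have "cinner (c *\<^sub>C x) (c *\<^sub>C x) = complex_of_real ((cmod c * norm x)\<^sup>2)"
    using complex_norm_square[of c]
    unfolding cinner_scaleC_left cinner_scaleC_right cinner_self[of x]
    by (simp add: power_mult_distrib)
  then have "(norm (c *\<^sub>C x))\<^sup>2 = (cmod c * norm x)\<^sup>2"
    by (metis cinner_self of_real_eq_iff)
  then show ?thesis
    by (simp add: power2_eq_iff_nonneg)
qed

lemma norm_add_square:
  "(norm (x + y))\<^sup>2 = (norm x)\<^sup>2 + (norm y)\<^sup>2 + 2 * Re (cinner (x::'a::complex_inner) y)"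
proof -
  have "Re (cinner y x) = Re (cinner x y)"
    by (metis cinner_commute cnj.simps(1))
  then show ?thesis
    by (simp add: power2_norm_cinner cinner_add_left cinner_add_right)
qed

lemma norm_diff_square:
  "(norm (x - y))\<^sup>2 = (norm x)\<^sup>2 + (norm y)\<^sup>2 - 2 * Re (cinner (x::'a::complex_inner) y)"
  using norm_add_square[of x "- y"] by (simp add: cinner_minus_right)

text \<open>Pythagoras for the component of \<open>x\<close> along \<open>y\<close>; the coefficient
  minimises the distance from \<open>x\<close> to the line through \<open>y\<close>. It gives both
  Cauchy-Schwarz and the orthogonality of closest points.\<close>

lemma norm_diff_scaleC_proj:
  fixes x y :: "'a::complex_inner"
  assumes "y \<noteq> 0"
  shows "(norm (x - (cinner y x / (norm y)\<^sup>2) *\<^sub>C y))\<^sup>2 = (norm x)\<^sup>2 - (cmod (cinner y x))\<^sup>2 / (norm y)\<^sup>2"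
proof -
  let ?c = "cinner y x / (norm y)\<^sup>2"
  have "cinner x (?c *\<^sub>C y) = complex_of_real ((cmod (cinner y x))\<^sup>2 / (norm y)\<^sup>2)"
    using cinner_commute[of x y] complex_norm_square[of "cinner y x"]
    by (simp add: cinner_scaleC_right)
  moreover have "(norm (?c *\<^sub>C y))\<^sup>2 = (cmod (cinner y x))\<^sup>2 / (norm y)\<^sup>2"
    using assms
    by (simp add: norm_scaleC norm_divide norm_power norm_mult power2_eq_square field_simps)
  ultimately show ?thesis
    by (simp add: norm_diff_square)
qed

lemma cinner_Cauchy_Schwarz: "cmod (cinner x (y::'a::complex_inner)) \<le> norm x * norm y"
proof (cases "x = 0")
  case False
  then have "(cmod (cinner x y))\<^sup>2 / (norm x)\<^sup>2 \<le> (norm y)\<^sup>2"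
    using norm_diff_scaleC_proj[of x y] by (smt (verit) zero_le_power2)
  with False have "(cmod (cinner x y))\<^sup>2 \<le> (norm x * norm y)\<^sup>2"
    by (simp add: power_mult_distrib divide_le_eq mult.commute)
  then show ?thesis
    by (rule power2_le_imp_le) simp
qed simp

lemma bounded_linear_cinner_right: "bounded_linear (cinner (x::'a::complex_inner))"
  by (rule bounded_linear_intro[where K = "norm x"])
    (simp_all add: cinner_add_right cinner_scaleR_right cinner_Cauchy_Schwarz mult.commute[of _ "norm x"])

lemma bounded_linear_scaleC_right: "bounded_linear (\<lambda>x::'a::complex_inner. c *\<^sub>C x)"
  by (rule bounded_linear_intro[where K = "cmod c"])
    (simp_all add: scaleC_add_right scaleR_scaleC scaleC_scaleC norm_scaleC mult.commute)

lemma cinner_eqI: "(\<And>y. cinner y x = cinner y x') \<Longrightarrow> x = (x'::'a::complex_inner)"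
  by (metis cinner_diff_right cinner_eq_zero_iff eq_iff_diff_eq_0)

lemma clinear_add: "clinear f \<Longrightarrow> f (x + y) = f x + f y"
  and clinear_scaleC: "clinear f \<Longrightarrow> f (c *\<^sub>C x) = c *\<^sub>C f x"
  by (simp_all add: clinear_def)

lemma clinear_zero: "clinear f \<Longrightarrow> f 0 = 0"
  by (metis clinear_scaleC scaleC_zero_left)

lemma clinear_diff: "clinear f \<Longrightarrow> f (x - y) = f x - f y"
  by (metis clinear_add add_diff_cancel_right' diff_add_cancel)

lemma clinear_minus: "clinear f \<Longrightarrow> f (- x) = - f x"
  by (metis clinear_scaleC scaleC_minus1)

lemma bounded_clinear_clinear: "bounded_clinear f \<Longrightarrow> clinear f"
  by (simp add: bounded_clinear_def)

lemma bounded_clinear_bounded_linear: "bounded_clinear f \<Longrightarrow> bounded_linear f"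
  unfolding bounded_clinear_def
  by (elim conjE exE) (rule bounded_linear_intro, auto simp: clinear_add clinear_scaleC scaleR_scaleC)

section \<open>Projection onto closed complex subspaces\<close>

definition csubspace :: "'a::complex_vector set \<Rightarrow> bool" where
  "csubspace M \<longleftrightarrow> 0 \<in> M \<and> (\<forall>x\<in>M. \<forall>y\<in>M. x + y \<in> M) \<and> (\<forall>c. \<forall>x\<in>M. c *\<^sub>C x \<in> M)"

lemma csubspace_diff: "csubspace M \<Longrightarrow> x \<in> M \<Longrightarrow> y \<in> M \<Longrightarrow> x - y \<in> M"
  unfolding csubspace_def by (metis scaleC_minus1 diff_conv_add_uminus)

text \<open>The parallelogram law for \<open>x - a\<close> and \<open>x - b\<close>. It forces
  minimising sequences in a subspace to be Cauchy.\<close>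

lemma norm_diff_midpoint:
  fixes a b x :: "'a::complex_inner"
  shows "(norm (a - b))\<^sup>2 = 2 * (norm (x - a))\<^sup>2 + 2 * (norm (x - b))\<^sup>2
      - 4 * (norm (x - (1/2) *\<^sub>R (a + b)))\<^sup>2"
proof -
  have "a - b = (x - b) - (x - a)" by simp
  then have 1: "(norm (a - b))\<^sup>2 = (norm (x - b))\<^sup>2 + (norm (x - a))\<^sup>2 - 2 * Re (cinner (x - b) (x - a))"
    by (metis norm_diff_square)
  have "(x - b) + (x - a) = 2 *\<^sub>R (x - (1/2) *\<^sub>R (a + b))"
    by (simp add: scaleR_2 algebra_simps)
  then have "(norm ((x - b) + (x - a)))\<^sup>2 = 4 * (norm (x - (1/2) *\<^sub>R (a + b)))\<^sup>2"
    by (simp add: power_mult_distrib)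
  then show ?thesis
    using 1 norm_add_square[of "x - b" "x - a"] by simp
qed

lemma closest_point_csubspace:
  fixes M :: "'a::chilbert_space set"
  assumes M: "csubspace M" "closed M"
  obtains p where "p \<in> M" "\<And>m. m \<in> M \<Longrightarrow> norm (x - p) \<le> norm (x - m)"
proof -
  define D where "D = (\<lambda>m. (norm (x - m))\<^sup>2) ` M"
  define \<delta> where "\<delta> = Inf D"
  have ne: "D \<noteq> {}" and bdd: "bdd_below D"
    using M by (auto simp: D_def csubspace_def intro!: bdd_belowI[of _ 0])
  have le: "\<delta> \<le> (norm (x - m))\<^sup>2" if "m \<in> M" for m
    unfolding \<delta>_def using that bdd by (auto simp: D_def intro: cInf_lower)
  have "\<exists>m\<in>M. (norm (x - m))\<^sup>2 < \<delta> + 1 / real (Suc n)" for n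
    using cInf_lessD[OF ne, of "\<delta> + 1 / real (Suc n)"] by (auto simp: \<delta>_def D_def)
  then obtain s where s: "\<And>n. s n \<in> M" "\<And>n. (norm (x - s n))\<^sup>2 < \<delta> + 1 / real (Suc n)"
    by metis
  have diff: "(norm (s m - s n))\<^sup>2 \<le> 2 / real (Suc m) + 2 / real (Suc n)" for m n
  proof -
    \<comment> \<open>The midpoint stays in \<open>M\<close>, so its squared distance to
      \<open>x\<close> is at least \<open>\<delta>\<close>; in the parallelogram identity all
      multiples of \<open>\<delta>\<close> then cancel.\<close>
    have "(1/2) *\<^sub>R (s m + s n) \<in> M"
      using M s unfolding csubspace_def by (metis scaleR_scaleC)
    from le[OF this] s(2)[of m] s(2)[of n] norm_diff_midpoint[of "s m" "s n" x] show ?thesis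
      by simp
  qed
  have "Cauchy s"
  proof (rule metric_CauchyI)
    fix e :: real assume e: "e > 0"
    obtain N where N: "4 / e\<^sup>2 < real N" using reals_Archimedean2 by blast
    have "dist (s m) (s n) < e" if "m \<ge> N" "n \<ge> N" for m n
    proof -
      have *: "2 / real (Suc k) < e\<^sup>2 / 2" if "k \<ge> N" for k
      proof -
        have "4 / e\<^sup>2 < real (Suc k)" using N that by linarith
        then show ?thesis using e by (simp add: field_simps)
      qed
      have "(norm (s m - s n))\<^sup>2 < e\<^sup>2"
        using diff[of m n] *[OF that(1)] *[OF that(2)] by linarith
      then show ?thesis
        using e by (simp add: dist_norm power2_less_imp_less)
    qed
    then show "\<exists>N. \<forall>m\<ge>N. \<forall>n\<ge>N. dist (s m) (s n) < e" by blast
  qed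
  then obtain p where p: "s \<longlonglongrightarrow> p"
    using Cauchy_convergent_iff convergent_def by blast
  have "(\<lambda>n. (norm (x - s n))\<^sup>2) \<longlonglongrightarrow> (norm (x - p))\<^sup>2"
    by (intro tendsto_intros p)
  moreover have "(\<lambda>n. \<delta> + 1 / real (Suc n)) \<longlonglongrightarrow> \<delta> + 0"
    by (intro tendsto_intros LIMSEQ_inverse_real_of_nat[unfolded inverse_eq_divide])
  ultimately have "(norm (x - p))\<^sup>2 \<le> \<delta>"
    using s(2) by (metis (no_types, lifting) LIMSEQ_le add.right_neutral less_imp_le)
  then have "norm (x - p) \<le> norm (x - m)" if "m \<in> M" for m
    using le[OF that] by (meson norm_ge_zero order_trans power2_le_imp_le)
  moreover have "p \<in> M"
    using closed_sequentially[OF M(2) _ p] s(1) by blast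
  ultimately show thesis
    using that by blast
qed

text \<open>If the closest point \<open>p\<close> left \<open>x - p\<close> non-orthogonal to some
  \<open>m\<close>, moving \<open>p\<close> along \<open>m\<close> by the projection coefficient
  would bring it strictly closer to \<open>x\<close>.\<close>

lemma orthogonal_decomposition:
  fixes M :: "'a::chilbert_space set"
  assumes M: "csubspace M" "closed M"
  obtains p where "p \<in> M" "\<And>m. m \<in> M \<Longrightarrow> cinner m (x - p) = 0"
proof -
  obtain p where p: "p \<in> M" "\<And>m. m \<in> M \<Longrightarrow> norm (x - p) \<le> norm (x - m)"
    using closest_point_csubspace[OF M, of x] by blast
  have "cinner m (x - p) = 0" if m: "m \<in> M" for m
  proof (cases "m = 0")
    case False
    define c where "c = cinner m (x - p) / (norm m)\<^sup>2"
    have "p + c *\<^sub>C m \<in> M"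
      using M(1) p(1) m by (simp add: csubspace_def)
    then have "norm (x - p) \<le> norm (x - p - c *\<^sub>C m)"
      using p(2)[of "p + c *\<^sub>C m"] by (simp add: diff_diff_eq)
    then have "(norm (x - p))\<^sup>2 \<le> (norm (x - p - c *\<^sub>C m))\<^sup>2"
      by (simp add: power_mono)
    then have "(cmod (cinner m (x - p)))\<^sup>2 / (norm m)\<^sup>2 \<le> 0"
      using norm_diff_scaleC_proj[OF False, of "x - p"] unfolding c_def by linarith
    then show ?thesis
      using False by (simp add: divide_le_0_iff)
  qed simp
  with p show thesis using that by blast
qed

text \<open>Riesz representation, needed because \<open>cadjoint\<close> is a choice. As
  \<open>cinner\<close> is linear in its second argument, the functional represented is
  \<open>cinner y (T x)\<close>.\<close>

lemma cadjoint_exists: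
  fixes T :: "'a::chilbert_space \<Rightarrow> 'b::complex_inner"
  assumes T: "bounded_clinear T"
  shows "\<exists>S. \<forall>x y. cinner (T x) y = cinner x (S y)"
proof -
  note lin = bounded_clinear_clinear[OF T]
  have "\<exists>z. \<forall>x. cinner (T x) y = cinner x z" for y
  proof -
    define f where "f x = cinner y (T x)" for x
    have f: "f (u + v) = f u + f v" "f (c *\<^sub>C u) = c * f u" "f (u - v) = f u - f v" for u v c
      using lin by (simp_all add: f_def clinear_add clinear_scaleC clinear_diff cinner_add_right
          cinner_scaleC_right cinner_diff_right)
    have "continuous_on UNIV f"
      unfolding f_def
      by (intro linear_continuous_on bounded_linear_compose[OF bounded_linear_cinner_right]
          bounded_clinear_bounded_linear T)
    then have "closed {x. f x = 0}"
      by (intro closed_Collect_eq continuous_intros)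
    moreover have "csubspace {x. f x = 0}"
      using f(1,2) f(2)[of 0 0] by (simp add: csubspace_def)
    ultimately have dec: "\<exists>p. f p = 0 \<and> (\<forall>m. f m = 0 \<longrightarrow> cinner m (x - p) = 0)" for x
      by - (rule orthogonal_decomposition[of "{x. f x = 0}" x]; blast)
    show ?thesis
    proof (cases "\<forall>x. f x = 0")
      case True
      then have "\<forall>x. cinner (T x) y = cinner x 0"
        by (simp add: f_def cinner_commute[of "T _" y])
      then show ?thesis ..
    next
      case False
      then obtain x0 where x0: "f x0 \<noteq> 0" by blast
      obtain p where p: "f p = 0" "\<And>m. f m = 0 \<Longrightarrow> cinner m (x0 - p) = 0"
        using dec[of x0] by blast
      define e where "e = x0 - p"
      have fe: "f e \<noteq> 0" using x0 p f(3) by (simp add: e_def)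
      have e0: "cinner e e \<noteq> 0"
        using fe f(2)[of 0 e] by (auto simp: cinner_eq_zero_iff)
      have "cinner (T x) y = cinner x ((cnj (f e) / cinner e e) *\<^sub>C e)" for x
      proof -
        \<comment> \<open>The kernel of \<open>f\<close> has codimension one: removing a multiple of
          \<open>e\<close> brings any \<open>x\<close> into it, and \<open>e\<close> is orthogonal
          to it.\<close>
        have "f (x - (f x / f e) *\<^sub>C e) = 0"
          using fe by (simp add: f)
        then have "cinner (x - (f x / f e) *\<^sub>C e) e = 0"
          using p(2) e_def by simp
        then have "cinner x e = cnj (f x / f e) * cinner e e"
          by (simp add: cinner_diff_left cinner_scaleC_left)
        then have "cinner x ((cnj (f e) / cinner e e) *\<^sub>C e) = cnj (f x)"
          using fe e0 by (simp add: cinner_scaleC_right)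
        then show ?thesis
          using cinner_commute[of "T x" y] by (simp add: f_def)
      qed
      then show ?thesis by blast
    qed
  qed
  then show ?thesis by metis
qed

lemma cinner_cadjoint:
  fixes T :: "'a::chilbert_space \<Rightarrow> 'b::complex_inner"
  assumes "bounded_clinear T"
  shows "cinner (T x) y = cinner x (cadjoint T y)"
  using someI_ex[OF cadjoint_exists[OF assms]] unfolding cadjoint_def by blast

section \<open>The Hilbert space direct sum of two spaces\<close>

instantiation prod :: (complex_vector, complex_vector) complex_vector
begin

definition scaleC_prod_def: "c *\<^sub>C w = (c *\<^sub>C fst w, c *\<^sub>C snd w)"

instance
  by standard
    (simp_all add: scaleC_prod_def scaleC_add_right scaleC_add_left scaleC_scaleC scaleC_one
      scaleR_scaleC scaleR_prod_def)

end

instantiation prod :: (complex_inner, complex_inner) complex_inner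
begin

definition cinner_prod_def: "cinner w z = cinner (fst w) (fst z) + cinner (snd w) (snd z)"

instance
proof
  fix x y z :: "'a \<times> 'b" and r :: complex
  show "cinner x y = cnj (cinner y x)"
    by (simp add: cinner_prod_def flip: cinner_commute)
  show "cinner (x + y) z = cinner x z + cinner y z"
    by (simp add: cinner_prod_def cinner_add_left)
  show "cinner (r *\<^sub>C x) y = cnj r * cinner x y"
    by (simp add: cinner_prod_def scaleC_prod_def cinner_scaleC_left distrib_left)
  show "0 \<le> Re (cinner x x)"
    by (simp add: cinner_prod_def cinner_Re_nonneg)
  have "cinner x x = complex_of_real ((norm (fst x))\<^sup>2 + (norm (snd x))\<^sup>2)"
    by (simp add: cinner_prod_def cinner_self)
  then show "cinner x x = 0 \<longleftrightarrow> x = 0"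
    by (simp add: prod_eq_iff sum_power2_eq_zero_iff del: of_real_add)
  show "norm x = sqrt (Re (cinner x x))"
    by (simp add: norm_prod_def cinner_prod_def power2_norm_cinner)
qed

end

instance prod :: (chilbert_space, chilbert_space) chilbert_space
  by standard

section \<open>Equal kernels and unitary equivalence\<close>

text \<open>The abstract core: no structure on the index set \<open>I\<close> enters. In the
  application \<open>I\<close> is a polydisc and the two injectivity premises come from
  observability.\<close>

lemma unitary_of_equal_kernels:
  fixes E :: "'i \<Rightarrow> 'a::chilbert_space \<Rightarrow> 'c::complex_inner"
    and F :: "'i \<Rightarrow> 'b::chilbert_space \<Rightarrow> 'c"
  assumes E: "\<And>i. i \<in> I \<Longrightarrow> bounded_clinear (E i)"
    and F: "\<And>i. i \<in> I \<Longrightarrow> bounded_clinear (F i)"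
    and E_inj: "\<And>x. (\<And>i. i \<in> I \<Longrightarrow> E i x = 0) \<Longrightarrow> x = 0"
    and F_inj: "\<And>x. (\<And>i. i \<in> I \<Longrightarrow> F i x = 0) \<Longrightarrow> x = 0"
    and ker: "\<And>i j. i \<in> I \<Longrightarrow> j \<in> I \<Longrightarrow> E i \<circ> cadjoint (E j) = F i \<circ> cadjoint (F j)"
  obtains U where "unitary_op U" "\<And>i. i \<in> I \<Longrightarrow> E i = F i \<circ> U"
proof -
  note E_lin = bounded_clinear_clinear[OF E] and F_lin = bounded_clinear_clinear[OF F]
  \<comment> \<open>\<open>R\<close> is the future graph of \<open>U\<close>. \<open>M\<close> is
    the orthogonal complement of \<open>R\<close> with the sign of the second component flipped, and
    \<open>G i y\<close> are the pairs of adjoint vectors that link the two.\<close>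
  define R where "R = {w. \<forall>i\<in>I. E i (fst w) = F i (snd w)}"
  define M where "M = {w. \<forall>r\<in>R. cinner (fst r) (fst w) = cinner (snd r) (snd w)}"
  define G where "G i y = (cadjoint (E i) y, cadjoint (F i) y)" for i y
  have R: "csubspace R"
    using E_lin F_lin
    by (simp add: R_def csubspace_def clinear_zero clinear_add clinear_scaleC scaleC_prod_def)
  have M: "csubspace M"
    by (simp add: M_def csubspace_def scaleC_prod_def cinner_add_right cinner_scaleC_right)
  have "closed M"
  proof -
    have "M = (\<Inter>r\<in>R. {w. cinner (fst r) (fst w) = cinner (snd r) (snd w)})"
      by (auto simp: M_def)
    moreover have "closed {w :: 'a \<times> 'b. cinner a (fst w) = cinner b (snd w)}" for a b
      by (intro closed_Collect_eq linear_continuous_on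
          bounded_linear_compose[OF bounded_linear_cinner_right] bounded_linear_fst bounded_linear_snd)
    ultimately show ?thesis by auto
  qed
  \<comment> \<open>Kernel equality enters here and only here.\<close>
  have G_R: "G j y \<in> R" if "j \<in> I" for j y
    using ker[OF _ that] by (simp add: R_def G_def fun_eq_iff)
  have G_M: "G j y \<in> M" if "j \<in> I" for j y
    using that E F by (auto simp: M_def R_def G_def simp flip: cinner_cadjoint)
  have adj: "cinner (cadjoint (E i) y) x = cinner y (E i x)" "cinner (cadjoint (F i) y) x' = cinner y (F i x')"
    if "i \<in> I" for i x x' y
    using cinner_cadjoint[OF E[OF that]] cinner_cadjoint[OF F[OF that]] by (metis cinner_commute)+
  \<comment> \<open>Testing \<open>w\<close> against the elements \<open>G i y\<close> of
    \<open>R\<close> and moving the adjoints across gives the defining equation of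
    \<open>R\<close>.\<close>
  have M_R: "w \<in> R" if "w \<in> M" for w
  proof -
    have "E i (fst w) = F i (snd w)" if "i \<in> I" for i
      using \<open>w \<in> M\<close> G_R[OF that] unfolding M_def G_def
      by (intro cinner_eqI) (force simp flip: adj[OF that])
    then show ?thesis by (simp add: R_def)
  qed
  have perp_R: "(fst w, - snd w) \<in> R" if perp: "\<And>m. m \<in> M \<Longrightarrow> cinner m w = 0" for w
  proof -
    have "E i (fst w) = F i (- snd w)" if "i \<in> I" for i
      using perp[OF G_M[OF that]] that
      by (intro cinner_eqI)
        (simp add: cinner_prod_def G_def adj clinear_minus[OF F_lin] cinner_minus_right eq_neg_iff_add_eq_0)
    then show ?thesis by (simp add: R_def)
  qed
  have dec: "\<exists>m\<in>M. (fst (w - m), - snd (w - m)) \<in> R" for w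
    by (metis M \<open>closed M\<close> orthogonal_decomposition perp_R)
  have R0: "v = 0" if "(0, v) \<in> R" for v
    using that F_inj E_lin by (simp add: R_def clinear_zero)
  have R0': "u = 0" if "(u, 0) \<in> R" for u
    using that E_inj F_lin by (simp add: R_def clinear_zero)
  have R_add: "(a + a', b + b') \<in> R" if "(a, b) \<in> R" "(a', b') \<in> R" for a a' b b'
    using R that unfolding csubspace_def by (metis add_Pair)
  have R_diff: "(a - a', b - b') \<in> R" if "(a, b) \<in> R" "(a', b') \<in> R" for a a' b b'
    using csubspace_diff[OF R that] by simp
  \<comment> \<open>The remainder \<open>(u, v)\<close> of the projection onto \<open>M\<close> lies
    in \<open>R\<close>, and so does \<open>(u, - v)\<close>. Sum and difference lie on the two
    axes, where \<open>R\<close> is trivial.\<close>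
  have R_M: "w \<in> M" if w: "w \<in> R" for w
  proof -
    obtain m where m: "m \<in> M" "(fst (w - m), - snd (w - m)) \<in> R" using dec by blast
    define u v where "u = fst (w - m)" and "v = snd (w - m)"
    have 1: "(u, v) \<in> R" using csubspace_diff[OF R w M_R[OF m(1)]] by (simp add: u_def v_def del: fst_diff snd_diff)
    have 2: "(u, - v) \<in> R" using m(2) by (simp add: u_def v_def)
    have "2 *\<^sub>R v = 0" "2 *\<^sub>R u = 0"
      unfolding scaleR_2 using R0 R_diff[OF 1 2] R0' R_add[OF 1 2] by simp_all
    then have "v = 0" "u = 0" by simp_all
    then have "w = m" by (simp add: u_def v_def prod_eq_iff)
    then show ?thesis using m by simp
  qed
  have "\<exists>v. (x, v) \<in> R" for x
  proof -
    obtain m where m: "m \<in> M" "(fst ((x, 0) - m), - snd ((x, 0) - m)) \<in> R" using dec by blast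
    \<comment> \<open>Adding the sign-flipped remainder to \<open>m\<close> restores the first
      coordinate \<open>x\<close>; below, subtracting it restores the second coordinate
      \<open>v\<close>.\<close>
    have "(fst m + (x - fst m), snd m + snd m) \<in> R"
      using M_R[OF m(1)] m(2) by (intro R_add) simp_all
    then show ?thesis by auto
  qed
  then obtain U where U: "\<And>x. (x, U x) \<in> R" by metis
  have U_eq: "U x = v" if "(x, v) \<in> R" for x v
    using R0[of "U x - v"] R_diff[OF U[of x] that] by simp
  have iso: "cinner (U x) (U y) = cinner x y" for x y
    using R_M[OF U[of y]] U[of x] by (force simp: M_def)
  have "\<exists>x. U x = v" for v
  proof -
    obtain m where m: "m \<in> M" "(fst ((0, v) - m), - snd ((0, v) - m)) \<in> R" using dec by blast
    have "(fst m - (- fst m), snd m - (snd m - v)) \<in> R"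
      using M_R[OF m(1)] m(2) by (intro R_diff) simp_all
    then show ?thesis using U_eq by auto
  qed
  then have "surj U" by (metis surjI)
  moreover have "inj U"
  proof (rule injI)
    fix x y assume "U x = U y"
    then show "x = y" using R0'[of "x - y"] R_diff[OF U[of x] U[of y]] by simp
  qed
  moreover have "clinear U"
    unfolding clinear_def
  proof (intro conjI allI)
    show "U (x + y) = U x + U y" for x y by (intro U_eq R_add U)
    show "U (c *\<^sub>C x) = c *\<^sub>C U x" for c x
      using R U[of x] by (intro U_eq) (auto simp: csubspace_def scaleC_prod_def dest!: spec[of _ c])
  qed
  moreover have "norm (U x) \<le> norm x * 1" for x
    by (simp add: norm_eq_sqrt_cinner iso)
  ultimately have "unitary_op U"
    unfolding unitary_op_def bounded_clinear_def bij_def using iso by blast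
  moreover have "E i = F i \<circ> U" if "i \<in> I" for i
    using U that by (auto simp: R_def)
  ultimately show thesis using that by blast
qed

section \<open>Convergence on a polydisc\<close>

lemma fact_add_le: "fact (a + b) \<le> 2 ^ (a + b) * (fact a * fact b :: nat)"
proof -
  have "fact (a + b) = fact a * fact b * (a + b choose a)"
    using binomial_fact_lemma[of a "a + b"] by simp
  also have "\<dots> \<le> fact a * fact b * 2 ^ (a + b)"
    by (intro mult_left_mono binomial_le_pow2) simp
  finally show ?thesis by (simp add: mult.commute)
qed

text \<open>Splitting off one coordinate at a time costs a binomial coefficient, hence a power of 2.
  The base \<open>2 ^ d\<close> is crude, but the radius of the polydisc can absorb it.\<close>

lemma fact_sum_le: "fact (\<Sum>j<d. n j) \<le> (2 ^ d) ^ (\<Sum>j<d. n j) * (\<Prod>j<d. fact (n j) :: nat)"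
proof (induction d)
  case (Suc d)
  let ?s = "\<Sum>j<d. n j" and ?p = "\<Prod>j<d. fact (n j) :: nat"
  have "fact (?s + n d) \<le> 2 ^ (?s + n d) * (fact ?s * fact (n d) :: nat)"
    by (rule fact_add_le)
  also have "\<dots> \<le> 2 ^ (?s + n d) * (((2 ^ d) ^ ?s * ?p) * fact (n d))"
    by (intro mult_left_mono mult_right_mono Suc.IH) simp_all
  also have "\<dots> \<le> 2 ^ (?s + n d) * (((2 ^ d) ^ (?s + n d) * ?p) * fact (n d))"
    by (intro mult_left_mono mult_right_mono power_increasing) simp_all
  finally show ?case
    by (simp add: power_mult_distrib mult_ac)
qed simp

lemma norm_multinom_le: "cmod (multinom d n) \<le> (2 ^ d) ^ (\<Sum>j<d. n j)"
proof -
  have "real (fact (\<Sum>j<d. n j)) \<le> real ((2 ^ d) ^ (\<Sum>j<d. n j) * (\<Prod>j<d. fact (n j)))"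
    using fact_sum_le[of n d] by (simp only: of_nat_le_iff)
  moreover have "real (\<Prod>j<d. fact (n j)) > 0"
    by (simp add: prod_pos)
  ultimately show ?thesis
    unfolding multinom_def norm_divide norm_of_nat by (simp add: divide_le_eq)
qed

lemma multinom_nonzero: "multinom d n \<noteq> 0"
  by (simp add: multinom_def)

text \<open>Every finite set of multi-indices lies in a box, over which the sum factors into
  \<open>d\<close> partial geometric series, each at most \<open>1 / (1 - r)\<close>.\<close>

lemma summable_on_multiidx_power:
  fixes r :: real
  assumes r: "0 \<le> r" "r < 1"
  shows "(\<lambda>n. r ^ (\<Sum>j<d. n j)) summable_on multiidx d"
proof (rule nonneg_bdd_above_summable_on)
  show "bdd_above (sum (\<lambda>n. r ^ (\<Sum>j<d. n j)) ` {F. F \<subseteq> multiidx d \<and> finite F})"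
  proof (rule bdd_aboveI2)
    fix F assume "F \<in> {F. F \<subseteq> multiidx d \<and> finite F}"
    then have F: "F \<subseteq> multiidx d" "finite F" by auto
    \<comment> \<open>For empty \<open>F\<close> or \<open>d = 0\<close> this is
      \<open>Max {}\<close>, an unspecified number whose value does not matter.\<close>
    define N where "N = Max ((\<lambda>(n, j). n j) ` (F \<times> {..<d}))"
    have N: "n j \<le> N" if "n \<in> F" "j < d" for n j
      unfolding N_def using F that by (intro Max_ge) (auto intro!: rev_image_eqI[of "(n, j)"])
    \<comment> \<open>Multi-indices are 0 beyond \<open>d\<close>, while members of
      \<open>PiE\<close> are \<open>undefined\<close> there; restriction translates between the two
      encodings.\<close>
    have inj: "inj_on (\<lambda>n. restrict n {..<d}) F"
    proof (rule inj_onI)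
      fix m n assume mn: "m \<in> F" "n \<in> F" and eq: "restrict m {..<d} = restrict n {..<d}"
      have "m j = n j" for j
      proof (cases "j < d")
        case True
        then show ?thesis using fun_cong[OF eq, of j] by simp
      next
        case False
        with F(1) mn have "m j = 0" "n j = 0" by (auto simp: multiidx_def)
        then show ?thesis by simp
      qed
      then show "m = n" by blast
    qed
    have "(\<Sum>n\<in>F. r ^ (\<Sum>j<d. n j)) = (\<Sum>n\<in>F. \<Prod>j<d. r ^ restrict n {..<d} j)"
      by (simp add: power_sum)
    also have "\<dots> = (\<Sum>g\<in>(\<lambda>n. restrict n {..<d}) ` F. \<Prod>j<d. r ^ g j)"
      by (simp add: sum.reindex[OF inj])
    also have "\<dots> \<le> (\<Sum>g\<in>PiE {..<d} (\<lambda>_. {..N}). \<Prod>j<d. r ^ g j)"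
      using N r by (intro sum_mono2) (auto intro!: finite_PiE prod_nonneg split: if_splits)
    also have "\<dots> = (\<Prod>j<d. \<Sum>k\<le>N. r ^ k)"
      by (rule prod_sum_PiE[symmetric]) auto
    also have "\<dots> \<le> (\<Prod>j<d. 1 / (1 - r))"
    proof (rule prod_mono)
      have "(\<Sum>k\<le>N. r ^ k) \<le> (\<Sum>k. r ^ k)"
        using r by (intro sum_le_suminf summable_geometric) auto
      then show "0 \<le> (\<Sum>k\<le>N. r ^ k) \<and> (\<Sum>k\<le>N. r ^ k) \<le> 1 / (1 - r)" for j
        using r by (simp add: suminf_geometric sum_nonneg)
    qed
    finally show "(\<Sum>n\<in>F. r ^ (\<Sum>j<d. n j)) \<le> (\<Prod>j<d. 1 / (1 - r))" .
  qed
qed (use r in simp)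

definition polydisc :: "nat \<Rightarrow> real \<Rightarrow> (nat \<Rightarrow> complex) set" where
  "polydisc d \<rho> = {lam. \<forall>j<d. cmod (lam j) \<le> \<rho>}"

lemma norm_mono_pow_le:
  assumes "lam \<in> polydisc d \<rho>"
  shows "cmod (mono_pow d lam n) \<le> \<rho> ^ (\<Sum>j<d. n j)"
  unfolding mono_pow_def power_sum prod_norm[symmetric] norm_power
  using assms by (intro prod_mono) (auto simp: polydisc_def power_mono)

section \<open>Linearity and bounds for operator monomials, and the series of
  \<open>Eop\<close>\<close>

lemma clinear_funpow: "clinear f \<Longrightarrow> clinear (f ^^ k)" for f :: "'a::complex_vector \<Rightarrow> 'a"
  by (induction k) (simp_all add: clinear_def)

lemma clinear_mpow: "(\<And>j. j < d \<Longrightarrow> clinear (A j)) \<Longrightarrow> clinear (mpow A d n)"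
proof (induction d)
  case (Suc d)
  then have "clinear (mpow A d n)" "clinear (A d ^^ n d)"
    by (auto intro: clinear_funpow)
  then show ?case by (simp add: clinear_def)
qed (simp add: clinear_def)

lemma norm_funpow_le:
  fixes f :: "'a::real_normed_vector \<Rightarrow> 'a"
  assumes "\<And>x. norm (f x) \<le> K * norm x" "0 \<le> K"
  shows "norm ((f ^^ k) x) \<le> K ^ k * norm x"
proof (induction k)
  case (Suc k)
  have "norm ((f ^^ Suc k) x) \<le> K * norm ((f ^^ k) x)"
    using assms(1) by simp
  also have "\<dots> \<le> K * (K ^ k * norm x)"
    using Suc assms(2) by (rule mult_left_mono)
  finally show ?case by (simp add: mult.assoc)
qed simp

lemma norm_mpow_le:
  fixes A :: "nat \<Rightarrow> 'a::real_normed_vector \<Rightarrow> 'a"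
  assumes "\<And>j x. j < d \<Longrightarrow> norm (A j x) \<le> K * norm x" "0 \<le> K"
  shows "norm (mpow A d n x) \<le> K ^ (\<Sum>j<d. n j) * norm x"
  using assms
proof (induction d arbitrary: x)
  case (Suc d)
  have "norm (mpow A (Suc d) n x) \<le> K ^ (\<Sum>j<d. n j) * norm ((A d ^^ n d) x)"
    using Suc by simp
  also have "\<dots> \<le> K ^ (\<Sum>j<d. n j) * (K ^ n d * norm x)"
    using Suc.prems by (intro mult_left_mono norm_funpow_le) auto
  finally show ?case by (simp add: power_add mult.assoc)
qed simp

text \<open>The last smallness condition balances three growth rates per degree:
  \<open>2 ^ d\<close> from the multinomial coefficient, \<open>\<rho>\<close> from the monomial and
  \<open>K\<close> from the operators. The terms then decay like \<open>(1/2) ^ k\<close> in the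
  total degree \<open>k\<close>.\<close>

context
  fixes d :: nat and C :: "'x::complex_inner \<Rightarrow> 'y::chilbert_space" and A :: "nat \<Rightarrow> 'x \<Rightarrow> 'x"
    and B K \<rho> :: real
  assumes C: "\<And>x. norm (C x) \<le> B * norm x"
    and A: "\<And>j x. j < d \<Longrightarrow> norm (A j x) \<le> K * norm x"
    and pos: "0 \<le> B" "0 \<le> K" "0 \<le> \<rho>" "2 ^ d * \<rho> * K \<le> 1 / 2"
begin

lemma norm_Eop_term_le:
  assumes lam: "lam \<in> polydisc d \<rho>"
  shows "norm ((multinom d n * mono_pow d lam n) *\<^sub>C C (mpow A d n x))
    \<le> B * norm x * (1/2) ^ (\<Sum>j<d. n j)"
proof -
  let ?k = "\<Sum>j<d. n j"
  have "norm (C (mpow A d n x)) \<le> B * (K ^ ?k * norm x)"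
    using C[of "mpow A d n x"] norm_mpow_le[of d A K n x] A pos
    by (meson mult_left_mono order_trans)
  then have "norm ((multinom d n * mono_pow d lam n) *\<^sub>C C (mpow A d n x))
      \<le> ((2 ^ d) ^ ?k * \<rho> ^ ?k) * (B * (K ^ ?k * norm x))"
    unfolding norm_scaleC norm_mult using pos
    by (intro mult_mono norm_multinom_le norm_mono_pow_le lam) simp_all
  also have "\<dots> = B * norm x * (2 ^ d * \<rho> * K) ^ ?k"
    by (simp add: power_mult_distrib)
  also have "\<dots> \<le> B * norm x * (1/2) ^ ?k"
    using pos by (intro mult_left_mono power_mono) auto
  finally show ?thesis .
qed

lemma summable_Eop_bound: "(\<lambda>n. B * norm x * (1/2) ^ (\<Sum>j<d. n j)) summable_on multiidx d"
  by (intro summable_on_cmult_right summable_on_multiidx_power) auto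

lemma abs_summable_Eop:
  assumes "lam \<in> polydisc d \<rho>"
  shows "(\<lambda>n. norm ((multinom d n * mono_pow d lam n) *\<^sub>C C (mpow A d n x))) summable_on multiidx d"
  by (rule Infinite_Sum.abs_summable_on_comparison_test'[OF summable_Eop_bound norm_Eop_term_le[OF assms]])

lemma has_sum_Eop:
  assumes "lam \<in> polydisc d \<rho>"
  shows "((\<lambda>n. (multinom d n * mono_pow d lam n) *\<^sub>C C (mpow A d n x)) has_sum Eop d C A lam x)
    (multiidx d)"
  unfolding Eop_def by (rule has_sum_infsum[OF Infinite_Sum.abs_summable_summable[OF abs_summable_Eop[OF assms]]])

text \<open>This makes \<open>cadjoint\<close> of \<open>Eop\<close> a genuine adjoint.\<close>

lemma bounded_clinear_Eop:
  assumes lam: "lam \<in> polydisc d \<rho>" and lin: "clinear C" "\<And>j. j < d \<Longrightarrow> clinear (A j)"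
  shows "bounded_clinear (Eop d C A lam)"
proof -
  have lin': "clinear (mpow A d n)" for n
    using lin(2) by (rule clinear_mpow)
  have "Eop d C A lam (x + y) = Eop d C A lam x + Eop d C A lam y" for x y
    using has_sum_add[OF has_sum_Eop[OF lam, of x] has_sum_Eop[OF lam, of y]]
      has_sum_Eop[OF lam, of "x + y"]
    by (simp add: clinear_add[OF lin'] clinear_add[OF lin(1)] scaleC_add_right has_sum_unique)
  moreover have "Eop d C A lam (c *\<^sub>C x) = c *\<^sub>C Eop d C A lam x" for c x
    using has_sum_bounded_linear[OF bounded_linear_scaleC_right has_sum_Eop[OF lam, of x], of c]
      has_sum_Eop[OF lam, of "c *\<^sub>C x"]
    by (simp add: clinear_scaleC[OF lin'] clinear_scaleC[OF lin(1)] scaleC_scaleC mult.commute has_sum_unique)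
  moreover have "norm (Eop d C A lam x) \<le> norm x * (B * (\<Sum>\<^sub>\<infinity>n\<in>multiidx d. (1/2) ^ (\<Sum>j<d. n j)))" for x
  proof -
    have "norm (Eop d C A lam x) \<le> (\<Sum>\<^sub>\<infinity>n\<in>multiidx d. B * norm x * (1/2) ^ (\<Sum>j<d. n j))"
      unfolding Eop_def
      by (rule order_trans[OF norm_infsum_bound infsum_mono])
        (use abs_summable_Eop[OF lam] summable_Eop_bound norm_Eop_term_le[OF lam] in auto)
    also have "\<dots> = norm x * (B * (\<Sum>\<^sub>\<infinity>n\<in>multiidx d. (1/2) ^ (\<Sum>j<d. n j)))"
      by (subst infsum_cmult_right) (auto intro: summable_on_multiidx_power)
    finally show ?thesis .
  qed
  ultimately show ?thesis
    unfolding bounded_clinear_def clinear_def by blast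
qed

end

section \<open>Uniqueness of power series coefficients\<close>

text \<open>A formal power series with positive radius of convergence is determined by its values
  near 0.\<close>

lemma powser_zero_imp_coeff_zero:
  fixes b :: "nat \<Rightarrow> complex"
  assumes r: "0 < r" and sums: "\<And>z. cmod z < r \<Longrightarrow> (\<lambda>n. b n * z ^ n) sums 0"
  shows "b n = 0"
proof -
  have "ereal (r / 2) \<le> conv_radius b"
    using conv_radius_geI[OF sums_summable[OF sums[of "of_real (r / 2)"]]] r by simp
  then have "0 < fps_conv_radius (Abs_fps b)"
    using r by (simp add: fps_conv_radius_def) (metis ereal_less(2) half_gt_zero less_le_trans)
  moreover have "eventually (\<lambda>z. eval_fps (Abs_fps b) z = eval_fps 0 z) (nhds 0)"
    unfolding eventually_nhds_metric
    using r sums by (intro exI[of _ r]) (auto simp: eval_fps_def sums_unique[symmetric])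
  ultimately have "Abs_fps b = 0"
    by (intro eval_fps_eqD) auto
  then show ?thesis
    by (metis fps_nth_Abs_fps fps_zero_nth)
qed

text \<open>The weights depend on \<open>n0\<close>: with two or more coordinates, no positive
  integer weights distinguish all multi-indices at once.\<close>

lemma separating_weights:
  fixes n0 :: "nat \<Rightarrow> nat"
  obtains w where "\<And>j. 0 < w j"
    "\<And>n. (\<Sum>j<d. w j * n j) = (\<Sum>j<d. w j * n0 j) \<Longrightarrow> \<forall>j<d. n j = n0 j"
proof -
  have "\<exists>w. (\<forall>j. 0 < w j) \<and> (\<forall>n. (\<Sum>j<d. w j * n j) = (\<Sum>j<d. w j * n0 j) \<longrightarrow> (\<forall>j<d. n j = n0 j))"
  proof (induction d)
    case 0
    show ?case by (rule exI[of _ "\<lambda>_. 1"]) simp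
  next
    case (Suc d)
    then obtain w where w: "\<And>j. 0 < w j"
      "\<And>n. (\<Sum>j<d. w j * n j) = (\<Sum>j<d. w j * n0 j) \<Longrightarrow> \<forall>j<d. n j = n0 j" by blast
    \<comment> \<open>The old weights become multiples of \<open>L\<close>, and the new weight is 1
      modulo \<open>L\<close> and larger than \<open>W\<close>. Reduction modulo
      \<open>L > n0 d\<close> shows that \<open>n d\<close> exceeds \<open>n0 d\<close> by a
      multiple \<open>L * t\<close>; after cancelling \<open>L\<close>, size forces
      \<open>t = 0\<close>.\<close>
    define L where "L = Suc (n0 d)"
    define W where "W = (\<Sum>j<d. w j * n0 j)"
    define w' where "w' j = (if j = d then L * W + 1 else L * w j)" for j
    have w'_sum: "(\<Sum>j<Suc d. w' j * n j) = L * (\<Sum>j<d. w j * n j) + (L * W + 1) * n d" for n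
      by (simp add: w'_def sum_distrib_left mult.assoc)
    have "\<forall>j<Suc d. n j = n0 j" if eq: "(\<Sum>j<Suc d. w' j * n j) = (\<Sum>j<Suc d. w' j * n0 j)" for n
    proof -
      define S where "S = (\<Sum>j<d. w j * n j)"
      have eq': "L * S + (L * W + 1) * n d = L * W + (L * W + 1) * n0 d"
        using eq unfolding w'_sum S_def W_def .
      have "(L * S + (L * W + 1) * n d) mod L = n d mod L"
        using mod_mult_self4[of L "S + W * n d" "n d"] by (simp add: algebra_simps)
      moreover have "(L * W + (L * W + 1) * n0 d) mod L = n0 d"
        using mod_mult_self4[of L "W + W * n0 d" "n0 d"] by (simp add: algebra_simps L_def)
      ultimately have "n d mod L = n0 d" unfolding eq' by simp
      then obtain t where t: "n d = n0 d + L * t"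
        by (metis add.commute mult_div_mod_eq)
      have "L * (S + (L * W + 1) * t) = L * W"
        using eq' by (simp add: t algebra_simps)
      then have St: "S + (L * W + 1) * t = W" by (subst (asm) mult_cancel1) (simp add: L_def)
      have "t = 0"
      proof (rule ccontr)
        assume "t \<noteq> 0"
        then have "(L * W + 1) * 1 \<le> (L * W + 1) * t" by (intro mult_le_mono2) simp
        also have "\<dots> \<le> W" using St by simp
        finally have "L * W + 1 \<le> W" by simp
        moreover have "W \<le> L * W" by (simp add: L_def)
        ultimately show False by linarith
      qed
      then show ?thesis
        using St t w(2)[of n] by (auto simp: S_def W_def less_Suc_eq)
    qed
    moreover have "0 < w' j" for j using w(1) by (simp add: w'_def L_def)
    ultimately show ?case by blast
  qed
  then show thesis using that by blast
qed

lemma power_series_zero_imp_coeff_zero: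
  fixes a :: "(nat \<Rightarrow> nat) \<Rightarrow> complex"
  assumes \<rho>: "0 < \<rho>"
    and zero: "\<And>lam. lam \<in> polydisc d \<rho> \<Longrightarrow> ((\<lambda>n. a n * mono_pow d lam n) has_sum 0) (multiidx d)"
    and n0: "n0 \<in> multiidx d"
  shows "a n0 = 0"
proof -
  obtain w where w: "\<And>j. 0 < w j"
    "\<And>n. (\<Sum>j<d. w j * n j) = (\<Sum>j<d. w j * n0 j) \<Longrightarrow> \<forall>j<d. n j = n0 j"
    using separating_weights[of d n0] by blast
  define g where "g n = (\<Sum>j<d. w j * n j)" for n
  define I where "I m = {n \<in> multiidx d. g n = m}" for m
  define b where "b m = (\<Sum>n\<in>I m. a n)" for m
  \<comment> \<open>Positive weights bound every coordinate by \<open>m\<close>, so each coefficient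
    \<open>b m\<close> of the one-variable series is a finite sum.\<close>
  have fin: "finite (I m)" for m
  proof (rule finite_subset)
    have "n j \<le> m" if "g n = m" "j < d" for n j
    proof -
      have "n j \<le> w j * n j" using w(1)[of j] by simp
      also have "\<dots> \<le> g n" unfolding g_def using that by (intro member_le_sum) auto
      finally show ?thesis using that by simp
    qed
    then show "I m \<subseteq> {f. \<forall>x. (x \<in> {..<d} \<longrightarrow> f x \<in> {..m}) \<and> (x \<notin> {..<d} \<longrightarrow> f x = 0)}"
      by (auto simp: I_def multiidx_def)
  qed (rule finite_set_of_finite_funs; simp)
  \<comment> \<open>The bound 1 on \<open>cmod z\<close> ensures that raising \<open>z\<close> to a
    positive power \<open>w j\<close> does not leave the polydisc.\<close>
  have "(\<lambda>m. b m * z ^ m) sums 0" if z: "cmod z < min \<rho> 1" for z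
  proof -
    define lam where "lam j = z ^ w j" for j
    have "cmod (lam j) \<le> \<rho>" for j
      using z w(1)[of j] power_decreasing[of 1 "w j" "cmod z"]
      by (simp add: lam_def norm_power)
    then have "((\<lambda>n. a n * mono_pow d lam n) has_sum 0) (multiidx d)"
      by (intro zero) (simp add: polydisc_def)
    then have "((\<lambda>n. a n * z ^ g n) has_sum 0) (multiidx d)"
      by (simp add: mono_pow_def lam_def g_def power_sum power_mult)
    also have "?this \<longleftrightarrow> ((\<lambda>(m, n). a n * z ^ m) has_sum 0) (Sigma UNIV I)"
      by (intro has_sum_reindex_bij_witness[of _ snd "\<lambda>n. (g n, n)"]) (auto simp: I_def)
    finally have "((\<lambda>m. b m * z ^ m) has_sum 0) UNIV"
      by (rule has_sum_Sigma')
        (use fin in \<open>auto simp: b_def sum_distrib_right intro: has_sum_finite\<close>)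
    then show ?thesis by (rule has_sum_imp_sums)
  qed
  then have "b (g n0) = 0"
    using \<rho> by (intro powser_zero_imp_coeff_zero[of "min \<rho> 1"]) auto
  \<comment> \<open>By the choice of weights, the coefficient at this degree consists of
    \<open>a n0\<close> alone.\<close>
  moreover have "I (g n0) = {n0}"
  proof -
    have "n = n0" if "n \<in> I (g n0)" for n
    proof
      fix j show "n j = n0 j"
        using that n0 w(2)[of n] by (cases "j < d") (auto simp: I_def g_def multiidx_def)
    qed
    then show ?thesis using n0 by (auto simp: I_def)
  qed
  ultimately show ?thesis by (simp add: b_def)
qed

section \<open>Words and multi-indices\<close>

lemma mpow_commute:
  assumes "\<And>i x. i < d \<Longrightarrow> B (A i x) = A i (B x)"
  shows "B (mpow A d n x) = mpow A d n (B x)"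
  using assms
proof (induction d arbitrary: x)
  case (Suc d)
  have "B ((A d ^^ k) y) = (A d ^^ k) (B y)" for k y
    by (induction k) (simp_all add: Suc.prems)
  then show ?case using Suc by simp
qed simp

lemma mpow_cong: "(\<And>j. j < d \<Longrightarrow> m j = n j) \<Longrightarrow> mpow A d m = mpow A d n"
  by (induction d) simp_all

text \<open>In \<open>mpow\<close> the last operator acts first, so an additional factor
  \<open>A j\<close> has to be commuted past those with smaller index.\<close>

lemma mpow_fun_upd_Suc:
  assumes comm: "\<And>i j x. i < d \<Longrightarrow> j < d \<Longrightarrow> A i (A j x) = A j (A i x)" and j: "j < d"
  shows "mpow A d (n(j := Suc (n j))) x = A j (mpow A d n x)"
  using assms
proof (induction d arbitrary: x)
  case (Suc d)
  show ?case
  proof (cases "j = d")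
    case True
    have "mpow A d (n(d := Suc (n d))) = mpow A d n"
      by (rule mpow_cong) simp
    moreover have "A d (mpow A d n y) = mpow A d n (A d y)" for y
      using Suc.prems(1) by (intro mpow_commute) simp
    ultimately show ?thesis using True by (simp del: fun_upd_apply add: fun_upd_same)
  next
    case False
    then show ?thesis using Suc by simp
  qed
qed simp

text \<open>The bridge between observability, phrased with words, and \<open>Eop\<close>, phrased
  with multi-indices: for commuting operators only the letter counts of a word matter.\<close>

lemma wpow_eq_mpow:
  assumes "commutative_tuple d A" and "v \<in> words d"
  shows "wpow A v x = mpow A d (count_list v) x"
  using assms(2)
proof (induction v)
  case Nil
  have "mpow A d (\<lambda>_. 0) x = x" by (induction d) simp_all
  then show ?case by simp
next
  case (Cons i v)
  have "count_list (i # v) = (count_list v)(i := Suc (count_list v i))" by auto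
  moreover have "A i (A j x) = A j (A i x)" if "i < d" "j < d" for i j x
    using assms(1) that by (metis comp_apply commutative_tuple_def)
  ultimately show ?case
    using Cons by (simp add: words_def mpow_fun_upd_Suc del: count_list.simps fun_upd_apply)
qed

lemma count_list_multiidx: "v \<in> words d \<Longrightarrow> count_list v \<in> multiidx d"
  by (force simp: words_def multiidx_def count_list_0_iff)

lemma wpow_append: "wpow A (u @ v) = wpow A u \<circ> wpow A v"
  by (induction u) (simp_all add: comp_assoc)

text \<open>Pairing with a fixed \<open>y\<close> reduces to scalar power series, and the
  multinomial factor is nonzero. Keeping two realizations in the statement serves both injectivity
  (one vector 0) and intertwining.\<close>

lemma eq_of_Eop_eq:
  fixes C :: "'x::chilbert_space \<Rightarrow> 'y::chilbert_space" and Ct :: "'xt::chilbert_space \<Rightarrow> 'y"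
  assumes \<rho>: "0 < \<rho>"
    and sum: "\<And>lam. lam \<in> polydisc d \<rho> \<Longrightarrow>
      ((\<lambda>n. (multinom d n * mono_pow d lam n) *\<^sub>C C (mpow A d n x)) has_sum Eop d C A lam x) (multiidx d)"
    and sumt: "\<And>lam. lam \<in> polydisc d \<rho> \<Longrightarrow>
      ((\<lambda>n. (multinom d n * mono_pow d lam n) *\<^sub>C Ct (mpow At d n xt)) has_sum Eop d Ct At lam xt) (multiidx d)"
    and eq: "\<And>lam. lam \<in> polydisc d \<rho> \<Longrightarrow> Eop d C A lam x = Eop d Ct At lam xt"
    and n: "n \<in> multiidx d"
  shows "C (mpow A d n x) = Ct (mpow At d n xt)"
proof (rule cinner_eqI)
  fix y
  define a where "a n = multinom d n * (cinner y (C (mpow A d n x)) - cinner y (Ct (mpow At d n xt)))" for n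
  have "((\<lambda>n. a n * mono_pow d lam n) has_sum 0) (multiidx d)" if lam: "lam \<in> polydisc d \<rho>" for lam
    using has_sum_add[OF has_sum_bounded_linear[OF bounded_linear_cinner_right sum[OF lam], of y]
        has_sum_bounded_linear[OF bounded_linear_cinner_right sumt[OF lam], of "- y"]] eq[OF lam]
    by (simp add: a_def cinner_scaleC_right cinner_minus_left algebra_simps)
  then have "a n = 0"
    using power_series_zero_imp_coeff_zero[OF \<rho> _ n] by blast
  then show "cinner y (C (mpow A d n x)) = cinner y (Ct (mpow At d n xt))"
    by (simp add: a_def multinom_nonzero)
qed

section \<open>Uniqueness of the observable realization\<close>

lemma bounded_clinear_uniform_bound:
  fixes A :: "nat \<Rightarrow> 'a::complex_inner \<Rightarrow> 'b::complex_inner"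
  assumes "\<forall>j<d. bounded_clinear (A j)"
  obtains K where "0 \<le> K" "\<And>j x. j < d \<Longrightarrow> norm (A j x) \<le> K * norm x"
proof -
  have "\<forall>j. \<exists>k. j < d \<longrightarrow> (\<forall>x. norm (A j x) \<le> norm x * k)"
    using assms unfolding bounded_clinear_def by blast
  then obtain k where k: "\<And>j x. j < d \<Longrightarrow> norm (A j x) \<le> norm x * k j" by metis
  \<comment> \<open>A sum of absolute values is nonnegative and, unlike a maximum, makes sense for
    \<open>d = 0\<close>.\<close>
  have "norm (A j x) \<le> (\<Sum>j<d. \<bar>k j\<bar>) * norm x" if "j < d" for j x
  proof -
    have "k j \<le> \<bar>k j\<bar>" by simp
    also have "\<dots> \<le> (\<Sum>j<d. \<bar>k j\<bar>)"
      using that by (intro member_le_sum) auto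
    finally have "norm x * k j \<le> (\<Sum>j<d. \<bar>k j\<bar>) * norm x"
      by (simp add: mult.commute mult_left_mono)
    with k[OF that, of x] show ?thesis by linarith
  qed
  then show thesis using that[of "\<Sum>j<d. \<bar>k j\<bar>"] by (simp add: sum_nonneg)
qed

lemma bounded_clinear_bound:
  assumes "bounded_clinear C"
  obtains B where "0 \<le> B" "\<And>x. norm (C x) \<le> B * norm x"
proof -
  have "\<forall>j<Suc 0. bounded_clinear C" using assms by simp
  then obtain B where "0 \<le> B" "\<And>j x. j < Suc 0 \<Longrightarrow> norm (C x) \<le> B * norm x"
    by (rule bounded_clinear_uniform_bound[of "Suc 0" "\<lambda>_. C"]) blast
  then show thesis using that by blast
qed

text \<open>Kernel equality is assumed on the ball, so the polydisc has to fit inside;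
  \<open>d < 2 ^ d\<close> reduces this to the radius condition.\<close>

lemma polydisc_subset_unit_ball:
  assumes "0 \<le> \<rho>" "2 ^ d * \<rho> \<le> 1 / 2"
  shows "polydisc d \<rho> \<subseteq> unit_ball d"
proof
  fix lam assume "lam \<in> polydisc d \<rho>"
  then have "(\<Sum>j<d. (cmod (lam j))\<^sup>2) \<le> (\<Sum>j<d. \<rho>\<^sup>2)"
    by (intro sum_mono power_mono) (auto simp: polydisc_def)
  also have "\<dots> = real d * \<rho> * \<rho>"
    by (simp add: power2_eq_square)
  also have "\<dots> \<le> 2 ^ d * \<rho> * \<rho>"
    using assms(1) of_nat_less_two_power[of d, where 'a = real] by (intro mult_right_mono) auto
  also have "\<dots> \<le> 1 / 2 * \<rho>"
    using assms by (intro mult_right_mono) auto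
  also have "\<rho> \<le> 2 ^ d * \<rho>"
    using assms(1) by (simp add: mult_le_cancel_right1)
  finally show "lam \<in> unit_ball d"
    using assms(2) by (simp add: unit_ball_def)
qed

theorem theorem3p17:
  fixes d :: nat
    and C :: "'x::chilbert_space \<Rightarrow> 'y::chilbert_space"
    and A :: "nat \<Rightarrow> 'x \<Rightarrow> 'x"
    and Ct :: "'xt::chilbert_space \<Rightarrow> 'y"
    and At :: "nat \<Rightarrow> 'xt \<Rightarrow> 'xt"
  assumes "bounded_clinear C" and "\<forall>j<d. bounded_clinear (A j)"
    and "bounded_clinear Ct" and "\<forall>j<d. bounded_clinear (At j)"
    and "output_stable d C A" and "observable d C A"
    and "output_stable d Ct At" and "observable d Ct At"
    and "commutative_tuple d A" and "commutative_tuple d At"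
    and "\<forall>lam\<in>unit_ball d. \<forall>\<zeta>\<in>unit_ball d. kernel_a d C A lam \<zeta> = kernel_a d Ct At lam \<zeta>"
  shows "\<exists>U :: 'x \<Rightarrow> 'xt. unitary_op U \<and> C = Ct \<circ> U \<and> (\<forall>j<d. A j = inv U \<circ> At j \<circ> U)"
proof -
  have C_lin: "clinear C" and Ct_lin: "clinear Ct"
    using assms(1,3) by (simp_all add: bounded_clinear_clinear)
  have A_lin: "clinear (A j)" and At_lin: "clinear (At j)" if "j < d" for j
    using assms(2,4) that by (simp_all add: bounded_clinear_clinear)
  obtain B where B: "0 \<le> B" "\<And>x. norm (C x) \<le> B * norm x"
    using bounded_clinear_bound[OF assms(1)] by blast
  obtain Bt where Bt: "0 \<le> Bt" "\<And>x. norm (Ct x) \<le> Bt * norm x"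
    using bounded_clinear_bound[OF assms(3)] by blast
  obtain K where K: "0 \<le> K" "\<And>j x. j < d \<Longrightarrow> norm (A j x) \<le> K * norm x"
    using bounded_clinear_uniform_bound[OF assms(2)] by blast
  obtain Kt where Kt: "0 \<le> Kt" "\<And>j x. j < d \<Longrightarrow> norm (At j x) \<le> Kt * norm x"
    using bounded_clinear_uniform_bound[OF assms(4)] by blast
  \<comment> \<open>The factor \<open>1 + K + Kt\<close> dominates 1, \<open>K\<close> and
    \<open>Kt\<close>, so one radius serves both series and the inclusion in the ball.\<close>
  define \<rho> where "\<rho> = 1 / (2 * 2 ^ d * (1 + K + Kt))"
  have \<rho>: "0 < \<rho>" "2 ^ d * \<rho> * K \<le> 1 / 2" "2 ^ d * \<rho> * Kt \<le> 1 / 2" "2 ^ d * \<rho> \<le> 1 / 2"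
    using K(1) Kt(1) by (simp_all add: \<rho>_def divide_le_eq)
  let ?D = "polydisc d \<rho>"
  note sum = has_sum_Eop[OF B(2) K(2) B(1) K(1) less_imp_le[OF \<rho>(1)] \<rho>(2)]
    and sumt = has_sum_Eop[OF Bt(2) Kt(2) Bt(1) Kt(1) less_imp_le[OF \<rho>(1)] \<rho>(3)]
  have E: "bounded_clinear (Eop d C A lam)" if "lam \<in> ?D" for lam
    using bounded_clinear_Eop[OF B(2) K(2) B(1) K(1) less_imp_le[OF \<rho>(1)] \<rho>(2) that C_lin A_lin] .
  have Et: "bounded_clinear (Eop d Ct At lam)" if "lam \<in> ?D" for lam
    using bounded_clinear_Eop[OF Bt(2) Kt(2) Bt(1) Kt(1) less_imp_le[OF \<rho>(1)] \<rho>(3) that Ct_lin At_lin] .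
  have words_eq: "C (wpow A v x) = Ct (wpow At v xt)"
    if "\<And>lam. lam \<in> ?D \<Longrightarrow> Eop d C A lam x = Eop d Ct At lam xt" "v \<in> words d" for v x xt
    using eq_of_Eop_eq[OF \<rho>(1) sum sumt that(1) count_list_multiidx[OF that(2)]]
    by (simp add: wpow_eq_mpow[OF assms(9) that(2)] wpow_eq_mpow[OF assms(10) that(2)])
  have wpow_zero: "C (wpow A v 0) = 0" "Ct (wpow At v 0) = 0" if "v \<in> words d" for v
    using that C_lin Ct_lin A_lin At_lin
    by (simp_all add: wpow_eq_mpow[OF assms(9) that] wpow_eq_mpow[OF assms(10) that]
        clinear_zero clinear_zero[OF clinear_mpow])
  obtain U where U: "unitary_op U" "\<And>lam. lam \<in> ?D \<Longrightarrow> Eop d C A lam = Eop d Ct At lam \<circ> U"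
  proof (rule unitary_of_equal_kernels[of ?D "Eop d C A" "Eop d Ct At"])
    show "x = 0" if "\<And>lam. lam \<in> ?D \<Longrightarrow> Eop d C A lam x = 0" for x
    proof -
      have "C (wpow A v x) = 0" if "v \<in> words d" for v
        \<comment> \<open>Comparison with the zero vector of the other realization turns vanishing
          of all \<open>Eop d C A lam x\<close> into vanishing of all observed words.\<close>
        using words_eq[of x 0 v] that
        by (simp add: wpow_zero \<open>\<And>lam. lam \<in> ?D \<Longrightarrow> Eop d C A lam x = 0\<close>
            clinear_zero[OF bounded_clinear_clinear[OF Et]])
      then show ?thesis using assms(6) by (simp add: observable_def)
    qed
    show "x = 0" if "\<And>lam. lam \<in> ?D \<Longrightarrow> Eop d Ct At lam x = 0" for x
    proof -
      have "Ct (wpow At v x) = 0" if "v \<in> words d" for v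
        using words_eq[of 0 x v] that
        by (simp add: wpow_zero \<open>\<And>lam. lam \<in> ?D \<Longrightarrow> Eop d Ct At lam x = 0\<close>
            clinear_zero[OF bounded_clinear_clinear[OF E]])
      then show ?thesis using assms(8) by (simp add: observable_def)
    qed
    show "Eop d C A lam \<circ> cadjoint (Eop d C A \<zeta>) = Eop d Ct At lam \<circ> cadjoint (Eop d Ct At \<zeta>)"
      if "lam \<in> ?D" "\<zeta> \<in> ?D" for lam \<zeta>
      using assms(11) polydisc_subset_unit_ball[OF less_imp_le[OF \<rho>(1)] \<rho>(4)] that
      unfolding kernel_a_def by blast
  qed (use E Et in blast)+
  have words_U: "C (wpow A v x) = Ct (wpow At v (U x))" if "v \<in> words d" for v x
    using U(2) that by (intro words_eq) simp_all
  \<comment> \<open>This is the case of the empty word.\<close>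
  have "C = Ct \<circ> U"
    using words_U[of "[]"] by (simp add: words_def fun_eq_iff)
  moreover have "A j = inv U \<circ> At j \<circ> U" if j: "j < d" for j
  proof -
    have "U (A j x) = At j (U x)" for x
    proof -
      have "Ct (wpow At v (U (A j x) - At j (U x))) = 0" if v: "v \<in> words d" for v
      proof -
        have vj: "v @ [j] \<in> words d" using v j by (simp add: words_def)
        \<comment> \<open>Both sides equal \<open>C (wpow A v (A j x))\<close>, read once as the
          word \<open>v\<close> at \<open>A j x\<close> and once as \<open>v @ [j]\<close> at
          \<open>x\<close>, since the rightmost letter acts first.\<close>
        have "Ct (wpow At v (U (A j x))) = Ct (wpow At v (At j (U x)))"
          using words_U[OF v, of "A j x"] words_U[OF vj, of x] by (simp add: wpow_append)
        moreover have "clinear (mpow At d n)" for n using At_lin by (rule clinear_mpow)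
        ultimately show ?thesis
          using Ct_lin by (simp add: wpow_eq_mpow[OF assms(10) v] clinear_diff)
      qed
      then have "U (A j x) - At j (U x) = 0"
        using assms(8) unfolding observable_def by blast
      then show ?thesis by simp
    qed
    then have "A j x = inv U (At j (U x))" for x
      using U(1) unfolding unitary_op_def by (metis bij_is_inj inv_f_f)
    then show ?thesis by (simp add: fun_eq_iff)
  qed
  ultimately show ?thesis using U(1) by blast
qed

end
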